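(* Let $G$ be a finite simple connected graph. Then $\mathrm{v}(J_G)=1$ if and only if $G=\mathrm{cone}(v,H)$ for some non-complete graph $H$ (and some vertex $v\notin V(H)$).
   Context: Let $K$ be a field. For a finite simple graph $G$ on $[n]$, the binomial edge ideal is $J_G=\langle x_iy_j-x_jy_i\mid\{i,j\}\in E(G), i<j\rangle$ in $S=K[x_1,\dots,x_n,y_1,\dots,y_n]$ (standard grading). For a proper graded ideal $I$ of $S$, $\mathrm{Ass}(I)$ is the set of associated primes of $S/I$ and $\mathrm{v}(I)=\min\{d\ge 0\mid \exists f\in S_d\text{ and }\mathfrak p\in\mathrm{Ass}(I)\text{ with }(I:f)=\mathfrak p\}$. For a simple graph $H$ and $v\notin V(H)$, $\mathrm{cone}(v,H)$ is the graph with vertex set $V(H)\cup\{v\}$ and edge set $E(H)\cup\{\{u,v\}\mid u\in V(H)\}$. A graph is complete if every pair of distinct vertices is joined by an edge. *)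

theory Defs
  imports "HOL-Library.Poly_Mapping" "HOL-Algebra.Ideal"
begin

record 'a graph =
  verts :: "'a set"
  edges :: "'a set set"

definition simple_graph :: "'a graph \<Rightarrow> bool" where
  "simple_graph G \<longleftrightarrow> (\<forall>e\<in>edges G. e \<subseteq> verts G \<and> card e = 2)"

definition adj_rel :: "'a graph \<Rightarrow> ('a \<times> 'a) set" where
  "adj_rel G = {(u, v). {u, v} \<in> edges G}"

definition connected_graph :: "'a graph \<Rightarrow> bool" where
  "connected_graph G \<longleftrightarrow>
     verts G \<noteq> {} \<and> (\<forall>u\<in>verts G. \<forall>v\<in>verts G. (u, v) \<in> (adj_rel G)\<^sup>*)"

definition complete_graph :: "'a graph \<Rightarrow> bool" where
  "complete_graph G \<longleftrightarrow>
     (\<forall>u\<in>verts G. \<forall>v\<in>verts G. u \<noteq> v \<longrightarrow> {u, v} \<in> edges G)"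

definition cone :: "'a \<Rightarrow> 'a graph \<Rightarrow> 'a graph" where
  "cone v H = \<lparr>verts = insert v (verts H), edges = edges H \<union> {{u, v} | u. u \<in> verts H}\<rparr>"

datatype 'a var = X 'a | Y 'a

text \<open>Polynomials are finitely supported coefficient functions on monomials, and monomials
  are finitely supported exponent functions on variables.\<close>

type_synonym ('a, 'k) bpoly = "('a var \<Rightarrow>\<^sub>0 nat) \<Rightarrow>\<^sub>0 'k"

definition var_poly :: "'a var \<Rightarrow> ('a, 'k::field) bpoly" where
  "var_poly z = Poly_Mapping.single (Poly_Mapping.single z 1) 1"

definition poly_ring :: "'a set \<Rightarrow> ('a, 'k::field) bpoly ring" where
  "poly_ring V =
     \<lparr>carrier = {p. \<forall>m\<in>Poly_Mapping.keys p. Poly_Mapping.keys m \<subseteq> X ` V \<union> Y ` V},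
      mult = (*), one = 1, zero = 0, add = (+)\<rparr>"

definition mon_degree :: "('a var \<Rightarrow>\<^sub>0 nat) \<Rightarrow> nat" where
  "mon_degree m = (\<Sum>z\<in>Poly_Mapping.keys m. Poly_Mapping.lookup m z)"

text \<open>As usual, the zero polynomial lies in every graded component.\<close>

definition graded_component :: "'a set \<Rightarrow> nat \<Rightarrow> ('a, 'k::field) bpoly set" where
  "graded_component V d =
     {f \<in> carrier (poly_ring V). \<forall>m\<in>Poly_Mapping.keys f. mon_degree m = d}"

definition colon :: "('r, 'm) ring_scheme \<Rightarrow> 'r set \<Rightarrow> 'r \<Rightarrow> 'r set" where
  "colon R I f = {g \<in> carrier R. g \<otimes>\<^bsub>R\<^esub> f \<in> I}"

text \<open>The associated primes of the module \<open>R / I\<close>: the prime ideals that are annihilators of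
  an element of \<open>R / I\<close>, the annihilator of the class of \<open>f\<close> being \<open>I : f\<close>.\<close>

definition assoc_primes :: "('r, 'm) ring_scheme \<Rightarrow> 'r set \<Rightarrow> 'r set set" where
  "assoc_primes R I = {P. primeideal P R \<and> (\<exists>f\<in>carrier R. P = colon R I f)}"

text \<open>\<open>Inf\<close> on \<open>nat\<close> is the minimum of a nonempty set. For a proper graded ideal the set is
  nonempty; should it be empty, the value would be \<open>0\<close>.\<close>

definition v_number :: "'a set \<Rightarrow> ('a, 'k::field) bpoly set \<Rightarrow> nat" where
  "v_number V I =
     Inf {d. \<exists>f\<in>graded_component V d. \<exists>P\<in>assoc_primes (poly_ring V) I.
               colon (poly_ring V) I f = P}"

text \<open>The vertices are drawn from an arbitrary linearly ordered type rather than being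
  literally \<open>1, \<dots>, n\<close>; the order only fixes the sign of the generators.\<close>

definition binomial_edge_ideal :: "'a::linorder graph \<Rightarrow> ('a, 'k::field) bpoly set" where
  "binomial_edge_ideal G =
     Idl\<^bsub>poly_ring (verts G)\<^esub>
       {var_poly (X i) * var_poly (Y j) - var_poly (X j) * var_poly (Y i) | i j.
          {i, j} \<in> edges G \<and> i < j}"

end

theory Submission
  imports Defs "HOL-Computational_Algebra.Polynomial"
begin

text \<open>Write \<open>[u,w]\<close> for the minor \<open>x\<^sub>u y\<^sub>w - x\<^sub>w y\<^sub>u\<close>, let \<open>J\<close> be the binomial edge ideal of the connected
  graph \<open>G\<close>, and let \<open>Q\<close> be the ideal of all minors, whether or not \<open>{u, w}\<close> is an edge. The ideal \<open>Q\<close>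
  is the kernel of the homomorphism \<open>x\<^sub>i \<mapsto> a\<^sub>i\<close>, \<open>y\<^sub>i \<mapsto> a\<^sub>i t\<close> into a polynomial ring, called \<open>segre\<close>
  below, and is therefore prime (\<open>segre_kernel_subset\<close>, \<open>segre_kernel_prime\<close>). Everything rests on
  comparing the colon ideals of \<open>J\<close> with \<open>Q\<close>, in three steps.

  \<^item> Let \<open>f\<close> be a form of degree at most one with \<open>J : f\<close> prime. Since \<open>f \<notin> Q\<close> and \<open>J \<subseteq> Q\<close>, the
    colon ideal lies in \<open>Q\<close>, so it contains no variable. The identity
    \<open>x\<^sub>w [u,z] = x\<^sub>u [w,z] + x\<^sub>z [u,w]\<close>, the expansion of a determinant with two equal rows, then
    carries membership of minors along the paths of \<open>G\<close>, and all minors lie in \<open>J : f\<close>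
    (\<open>low_degree_times_minor_in_edge_ideal\<close>).

  \<^item> If \<open>v\<close> and \<open>w\<close> are distinct and not adjacent, \<open>J\<close> vanishes at every point whose coordinates
    outside \<open>v\<close> and \<open>w\<close> are zero, because each edge has an endpoint with zero coordinates. Since
    \<open>[v,w]\<close> is nonzero at suitable such points, a linear form \<open>f\<close> with \<open>[v,w] f \<in> J\<close> cannot involve
    \<open>x\<^sub>v\<close> or \<open>y\<^sub>v\<close> (\<open>nonadjacent_coefficients_zero\<close>). Likewise, no nonzero constant multiplies
    \<open>[v,w]\<close> into \<open>J\<close>.

  \<^item> If \<open>v\<close> is adjacent to all other vertices, the same identity gives \<open>x\<^sub>v [u,w] \<in> J\<close> for all \<open>u\<close>
    and \<open>w\<close>, so \<open>J : x\<^sub>v = Q\<close> (\<open>colon_dominating_vertex\<close>).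

  Hence some constant has a prime colon ideal precisely when \<open>G\<close> is complete, and some linear form
  has one precisely when \<open>G\<close> has a vertex \<open>v\<close> adjacent to all others, in which case \<open>G\<close> is the cone
  from \<open>v\<close> over the rest. The v-number is one if the second condition holds and the first fails,
  and only then, provided that some form has a prime colon ideal at all. Such a form is a monomial:
  applying the identity along a path from \<open>u\<close> to \<open>w\<close> multiplies \<open>[u,w]\<close> into \<open>J\<close> by a monomial, and
  as \<open>G\<close> is finite, one monomial serves all pairs (\<open>ex_colon_monomial_eq_segre_kernel\<close>).\<close>

section \<open>Ring homomorphisms out of a monoid algebra\<close>

lemma poly_mapping_eq_sum_single:
  "p = (\<Sum>m\<in>Poly_Mapping.keys p. Poly_Mapping.single m (Poly_Mapping.lookup p m))"
proof (rule poly_mapping_eqI)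
  fix k
  have "(\<Sum>m\<in>Poly_Mapping.keys p.
           Poly_Mapping.lookup (Poly_Mapping.single m (Poly_Mapping.lookup p m)) k) =
        (\<Sum>m\<in>Poly_Mapping.keys p. if m = k then Poly_Mapping.lookup p k else 0)"
    by (intro sum.cong) (auto simp: lookup_single_not_eq)
  then show "Poly_Mapping.lookup p k = Poly_Mapping.lookup
      (\<Sum>m\<in>Poly_Mapping.keys p. Poly_Mapping.single m (Poly_Mapping.lookup p m)) k"
    by (simp add: lookup_sum in_keys_iff)
qed

lemma single_sum:
  "Poly_Mapping.single k (sum f A) = (\<Sum>x\<in>A. Poly_Mapping.single k (f x))"
  by (induction A rule: infinite_finite_induct) (auto simp: single_add)

lemma single_eq_zero_iff: "Poly_Mapping.single k a = 0 \<longleftrightarrow> a = 0"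
  by (metis lookup_single_eq lookup_zero single_zero)

lemma single_eq_single_iff:
  "a \<noteq> 0 \<Longrightarrow> Poly_Mapping.single k a = Poly_Mapping.single l a \<longleftrightarrow> k = l"
  by (metis keys_single singleton_inject)

text \<open>A ring homomorphism out of a monoid algebra is determined by its values on terms, that is, on
  monomials with a coefficient. Both homomorphisms used below, the Segre map and evaluation at a
  point, are obtained by prescribing these values.\<close>

locale term_hom =
  fixes w :: "'m::comm_monoid_add \<Rightarrow> 'k::field \<Rightarrow> 'r::comm_ring_1"
  assumes w_add: "w m (a + b) = w m a + w m b"
    and w_mult: "w (m + n) (a * b) = w m a * w n b"
    and w_one: "w 0 1 = 1"
begin

lemma w_zero [simp]: "w m 0 = 0"
  using w_add[of m 0 0] by simp

definition ext :: "('m \<Rightarrow>\<^sub>0 'k) \<Rightarrow> 'r" where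
  "ext p = (\<Sum>m\<in>Poly_Mapping.keys p. w m (Poly_Mapping.lookup p m))"

lemma ext_zero [simp]: "ext 0 = 0"
  by (simp add: ext_def)

lemma ext_single [simp]: "ext (Poly_Mapping.single m a) = w m a"
  by (simp add: ext_def)

lemma ext_one [simp]: "ext 1 = 1"
  by (metis ext_single single_one w_one)

lemma ext_add: "ext (p + q) = ext p + ext q"
  unfolding ext_def by (rule setsum_keys_plus_distrib) (auto simp: w_add)

lemma ext_sum: "ext (sum f A) = (\<Sum>x\<in>A. ext (f x))"
  by (induction A rule: infinite_finite_induct) (auto simp: ext_add)

lemma ext_diff: "ext (p - q) = ext p - ext q"
  using ext_add[of "p - q" q] by simp

lemma ext_mult: "ext (p * q) = ext p * ext q"
proof -
  let ?s = "\<lambda>p m. Poly_Mapping.single m (Poly_Mapping.lookup p m)"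
  have "p * q = (\<Sum>m\<in>Poly_Mapping.keys p. ?s p m) * (\<Sum>n\<in>Poly_Mapping.keys q. ?s q n)"
    by (simp flip: poly_mapping_eq_sum_single)
  then have "ext (p * q) = (\<Sum>m\<in>Poly_Mapping.keys p. \<Sum>n\<in>Poly_Mapping.keys q.
      w m (Poly_Mapping.lookup p m) * w n (Poly_Mapping.lookup q n))"
    by (simp add: sum_product ext_sum mult_single w_mult)
  also have "\<dots> = ext p * ext q"
    by (simp add: ext_def sum_product)
  finally show ?thesis .
qed

end

section \<open>Polynomial rings on a vertex set and their ideals\<close>

lemma poly_ring_simps [simp]:
  "monoid.mult (poly_ring V) = (*)" "monoid.one (poly_ring V) = 1"
  "ring.zero (poly_ring V) = 0" "ring.add (poly_ring V) = (+)"
  by (simp_all add: poly_ring_def)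

lemma poly_ring_carrier_iff:
  "p \<in> carrier (poly_ring V) \<longleftrightarrow>
     (\<forall>m\<in>Poly_Mapping.keys p. Poly_Mapping.keys m \<subseteq> X ` V \<union> Y ` V)"
  by (simp add: poly_ring_def)

lemma poly_ring_zero_closed: "0 \<in> carrier (poly_ring V)"
  and poly_ring_one_closed: "1 \<in> carrier (poly_ring V)"
  and poly_ring_uminus_closed: "p \<in> carrier (poly_ring V) \<Longrightarrow> - p \<in> carrier (poly_ring V)"
  and poly_ring_var_closed: "i \<in> V \<Longrightarrow> var_poly (X i) \<in> carrier (poly_ring V)"
    "i \<in> V \<Longrightarrow> var_poly (Y i) \<in> carrier (poly_ring V)"
  by (auto simp: poly_ring_carrier_iff var_poly_def)

lemma poly_ring_add_closed:
  "p \<in> carrier (poly_ring V) \<Longrightarrow> q \<in> carrier (poly_ring V) \<Longrightarrow> p + q \<in> carrier (poly_ring V)"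
  unfolding poly_ring_carrier_iff using keys_add[of p q] by blast

lemma poly_ring_diff_closed:
  "p \<in> carrier (poly_ring V) \<Longrightarrow> q \<in> carrier (poly_ring V) \<Longrightarrow> p - q \<in> carrier (poly_ring V)"
  unfolding poly_ring_carrier_iff using keys_diff[of p q] by blast

lemma poly_ring_mult_closed:
  assumes "p \<in> carrier (poly_ring V)" "q \<in> carrier (poly_ring V)"
  shows "p * q \<in> carrier (poly_ring V)"
  unfolding poly_ring_carrier_iff
proof
  fix m assume "m \<in> Poly_Mapping.keys (p * q)"
  then obtain a b where "m = a + b" "a \<in> Poly_Mapping.keys p" "b \<in> Poly_Mapping.keys q"
    using keys_mult[of p q] by blast
  then show "Poly_Mapping.keys m \<subseteq> X ` V \<union> Y ` V"
    using assms keys_add[of a b] unfolding poly_ring_carrier_iff by blast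
qed

lemmas poly_ring_closed = poly_ring_zero_closed poly_ring_one_closed poly_ring_uminus_closed
  poly_ring_var_closed poly_ring_add_closed poly_ring_diff_closed poly_ring_mult_closed

lemma poly_ring_cring: "cring (poly_ring V)"
proof (rule cringI)
  show "abelian_group (poly_ring V)"
  proof (rule abelian_groupI)
    fix p assume "p \<in> carrier (poly_ring V)"
    then show "\<exists>q\<in>carrier (poly_ring V). q \<oplus>\<^bsub>poly_ring V\<^esub> p = \<zero>\<^bsub>poly_ring V\<^esub>"
      by (intro bexI[of _ "- p"]) (auto intro: poly_ring_closed)
  qed (auto simp: add_ac poly_ring_closed)
  show "comm_monoid (poly_ring V)"
    by (rule comm_monoidI) (auto simp: mult_ac poly_ring_closed)
qed (auto simp: algebra_simps)

lemma poly_ring_idealI: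
  fixes I :: "('a, 'k::field) bpoly set"
  assumes sub: "I \<subseteq> carrier (poly_ring V)" and zero: "0 \<in> I"
    and add: "\<And>p q. p \<in> I \<Longrightarrow> q \<in> I \<Longrightarrow> p + q \<in> I"
    and mult: "\<And>r p. r \<in> carrier (poly_ring V) \<Longrightarrow> p \<in> I \<Longrightarrow> r * p \<in> I"
  shows "ideal I (poly_ring V)"
proof (rule idealI)
  interpret cring "poly_ring V" by (rule poly_ring_cring)
  show "ring (poly_ring V)" by (rule ring_axioms)
  show "subgroup I (add_monoid (poly_ring V))"
  proof (rule add.subgroupI)
    fix p assume p: "p \<in> I"
    then have "- 1 * p \<in> I"
      by (intro mult) (auto intro: poly_ring_closed)
    moreover have "\<ominus>\<^bsub>poly_ring V\<^esub> p = - p"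
      by (rule minus_equality) (use p sub in \<open>auto intro: poly_ring_closed\<close>)
    ultimately show "\<ominus>\<^bsub>poly_ring V\<^esub> p \<in> I" by simp
  qed (use sub zero add in auto)
next
  fix p r :: "('a, 'k) bpoly"
  assume "p \<in> I" "r \<in> carrier (poly_ring V)"
  then have "r * p \<in> I" by (intro mult)
  then show "r \<otimes>\<^bsub>poly_ring V\<^esub> p \<in> I" "p \<otimes>\<^bsub>poly_ring V\<^esub> r \<in> I"
    by (simp_all add: mult.commute)
qed

text \<open>The closure properties of ideals in terms of the class operations, in which all later
  computations take place.\<close>

lemma poly_ring_idealD:
  fixes I :: "('a, 'k::field) bpoly set"
  assumes "ideal I (poly_ring V)"
  shows "p \<in> I \<Longrightarrow> p \<in> carrier (poly_ring V)" "0 \<in> I"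
    and "p \<in> I \<Longrightarrow> q \<in> I \<Longrightarrow> p + q \<in> I"
    and "p \<in> I \<Longrightarrow> r \<in> carrier (poly_ring V) \<Longrightarrow> r * p \<in> I"
    and "p \<in> I \<Longrightarrow> r \<in> carrier (poly_ring V) \<Longrightarrow> p * r \<in> I"
    and "p \<in> I \<Longrightarrow> - p \<in> I"
proof -
  interpret ideal I "poly_ring V" by fact
  show "p \<in> I \<Longrightarrow> p \<in> carrier (poly_ring V)"
    using a_subset by blast
  show "0 \<in> I"
    using additive_subgroup.zero_closed[OF is_additive_subgroup] by simp
  show "p \<in> I \<Longrightarrow> q \<in> I \<Longrightarrow> p + q \<in> I"
    using additive_subgroup.a_closed[OF is_additive_subgroup, of p q] by simp
  show "p \<in> I \<Longrightarrow> r \<in> carrier (poly_ring V) \<Longrightarrow> r * p \<in> I"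
    using I_l_closed[of p r] by simp
  show "p \<in> I \<Longrightarrow> r \<in> carrier (poly_ring V) \<Longrightarrow> p * r \<in> I"
    using I_r_closed[of p r] by simp
  show "p \<in> I \<Longrightarrow> - p \<in> I"
    using I_l_closed[of p "- 1"] by (simp add: poly_ring_uminus_closed poly_ring_one_closed)
qed

lemma poly_ring_ideal_sum:
  assumes "ideal I (poly_ring V)" "\<And>x. x \<in> A \<Longrightarrow> f x \<in> I"
  shows "sum f A \<in> I"
  using assms(2)
  by (induction A rule: infinite_finite_induct) (auto intro: poly_ring_idealD[OF assms(1)])

section \<open>Degrees of monomials\<close>

lemma nat_poly_mapping_split:
  fixes m :: "'z \<Rightarrow>\<^sub>0 nat"
  assumes "z \<in> Poly_Mapping.keys m"
  obtains n where "m = Poly_Mapping.single z 1 + n"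
    "Poly_Mapping.keys n \<subseteq> Poly_Mapping.keys m"
proof
  let ?n = "m - Poly_Mapping.single z 1"
  show "m = Poly_Mapping.single z 1 + ?n"
    using assms
    by (intro poly_mapping_eqI)
      (auto simp: lookup_add lookup_minus lookup_single in_keys_iff when_def)
  show "Poly_Mapping.keys ?n \<subseteq> Poly_Mapping.keys m"
    by (auto simp: in_keys_iff lookup_minus)
qed

lemma nat_poly_mapping_induct [case_names zero single]:
  fixes m :: "'z \<Rightarrow>\<^sub>0 nat"
  assumes zero: "P 0" and single: "\<And>z n. P n \<Longrightarrow> P (Poly_Mapping.single z 1 + n)"
  shows "P m"
proof (induction "\<Sum>z\<in>Poly_Mapping.keys m. Poly_Mapping.lookup m z" arbitrary: m)
  case 0
  then have "m = 0"
    by (intro poly_mapping_eqI)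
      (metis (full_types) finite_keys lookup_zero not_in_keys_iff_lookup_eq_zero sum_eq_0_iff)
  then show ?case using zero by simp
next
  case (Suc k)
  then obtain z where "z \<in> Poly_Mapping.keys m"
    by (metis equals0I nat.simps(3) sum.empty)
  then obtain n where n: "m = Poly_Mapping.single z 1 + n"
    by (rule nat_poly_mapping_split)
  have "(\<Sum>z\<in>Poly_Mapping.keys m. Poly_Mapping.lookup m z) =
        1 + (\<Sum>z\<in>Poly_Mapping.keys n. Poly_Mapping.lookup n z)"
    unfolding n by (subst setsum_keys_plus_distrib) auto
  with Suc have "P n" by simp
  then show ?case unfolding n by (rule single)
qed

lemma mon_degree_add: "mon_degree (m + n) = mon_degree m + mon_degree n"
  unfolding mon_degree_def by (rule setsum_keys_plus_distrib) auto

lemma mon_degree_single [simp]: "mon_degree (Poly_Mapping.single z k) = k"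
  by (simp add: mon_degree_def)

lemma nat_poly_mapping_nonzeroE:
  fixes m :: "'z \<Rightarrow>\<^sub>0 nat"
  assumes "m \<noteq> 0"
  obtains z n where "m = Poly_Mapping.single z 1 + n"
proof -
  from assms obtain z where "z \<in> Poly_Mapping.keys m"
    by (metis keys_eq_empty equals0I)
  then show thesis by (rule nat_poly_mapping_split) (rule that)
qed

lemma mon_degree_eq_0D:
  assumes "mon_degree m = 0"
  shows "m = 0"
  using assms by (metis add_is_0 mon_degree_add mon_degree_single nat_poly_mapping_nonzeroE one_neq_zero)

lemma mon_degree_eq_1E:
  assumes "mon_degree m = 1"
  obtains z where "m = Poly_Mapping.single z 1"
proof -
  have "m \<noteq> 0"
    using assms by (auto simp: mon_degree_def)
  then obtain z n where m: "m = Poly_Mapping.single z 1 + n"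
    by (rule nat_poly_mapping_nonzeroE)
  with assms have "n = 0"
    by (intro mon_degree_eq_0D) (simp add: mon_degree_add)
  with m show thesis by (intro that) simp
qed

primrec vertex :: "'a var \<Rightarrow> 'a" where
  "vertex (X i) = i"
| "vertex (Y i) = i"

primrec x_count :: "'a var \<Rightarrow> nat \<Rightarrow> nat" where
  "x_count (X i) k = k"
| "x_count (Y i) k = 0"

primrec y_count :: "'a var \<Rightarrow> nat \<Rightarrow> nat" where
  "y_count (X i) k = 0"
| "y_count (Y i) k = k"

definition x_degree :: "('a var \<Rightarrow>\<^sub>0 nat) \<Rightarrow> nat" where
  "x_degree m = (\<Sum>z\<in>Poly_Mapping.keys m. x_count z (Poly_Mapping.lookup m z))"

definition y_degree :: "('a var \<Rightarrow>\<^sub>0 nat) \<Rightarrow> nat" where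
  "y_degree m = (\<Sum>z\<in>Poly_Mapping.keys m. y_count z (Poly_Mapping.lookup m z))"

definition vertex_degree :: "('a var \<Rightarrow>\<^sub>0 nat) \<Rightarrow> ('a \<Rightarrow>\<^sub>0 nat)" where
  "vertex_degree m =
     (\<Sum>z\<in>Poly_Mapping.keys m. Poly_Mapping.single (vertex z) (Poly_Mapping.lookup m z))"

lemma x_count_0 [simp]: "x_count z 0 = 0"
  and x_count_add: "x_count z (k + l) = x_count z k + x_count z l"
  and y_count_0 [simp]: "y_count z 0 = 0"
  and y_count_add: "y_count z (k + l) = y_count z k + y_count z l"
  by (cases z; simp)+

lemma degree_add:
  "x_degree (m + n) = x_degree m + x_degree n"
  "y_degree (m + n) = y_degree m + y_degree n"
  "vertex_degree (m + n) = vertex_degree m + vertex_degree n"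
  unfolding x_degree_def y_degree_def vertex_degree_def
  by (rule setsum_keys_plus_distrib; simp add: x_count_add y_count_add single_add)+

lemma degree_zero [simp]: "x_degree 0 = 0" "y_degree 0 = 0" "vertex_degree 0 = 0"
  by (simp_all add: x_degree_def y_degree_def vertex_degree_def)

lemma degree_single [simp]:
  "x_degree (Poly_Mapping.single z k) = x_count z k"
  "y_degree (Poly_Mapping.single z k) = y_count z k"
  "vertex_degree (Poly_Mapping.single z k) = Poly_Mapping.single (vertex z) k"
  by (cases "k = 0"; simp add: x_degree_def y_degree_def vertex_degree_def)+

text \<open>Consequently \<open>vertex_degree\<close> and \<open>y_degree\<close> together determine \<open>x_degree\<close>, so the image of a
  monomial under \<open>segre\<close> need only record the first two.\<close>

lemma x_degree_plus_y_degree: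
  "x_degree m + y_degree m =
     (\<Sum>i\<in>Poly_Mapping.keys (vertex_degree m). Poly_Mapping.lookup (vertex_degree m) i)"
proof (induction m rule: nat_poly_mapping_induct)
  case (single z n)
  then show ?case
    by (cases z) (simp_all add: degree_add setsum_keys_plus_distrib[where f = "\<lambda>_ k. k"])
qed simp

lemma x_degree_nonzeroD:
  assumes "x_degree m \<noteq> 0"
  obtains j where "X j \<in> Poly_Mapping.keys m"
proof -
  from assms obtain z where z: "z \<in> Poly_Mapping.keys m" "x_count z (Poly_Mapping.lookup m z) \<noteq> 0"
    unfolding x_degree_def by (meson sum.neutral)
  then show thesis using that by (cases z) auto
qed

lemma y_degree_nonzeroD:
  assumes "y_degree m \<noteq> 0"
  obtains j where "Y j \<in> Poly_Mapping.keys m"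
proof -
  from assms obtain z where z: "z \<in> Poly_Mapping.keys m" "y_count z (Poly_Mapping.lookup m z) \<noteq> 0"
    unfolding y_degree_def by (meson sum.neutral)
  then show thesis using that by (cases z) auto
qed

lemma vertex_degree_nonzeroD:
  assumes "Poly_Mapping.lookup (vertex_degree m) i \<noteq> 0"
  shows "X i \<in> Poly_Mapping.keys m \<or> Y i \<in> Poly_Mapping.keys m"
proof -
  from assms obtain z where z: "z \<in> Poly_Mapping.keys m"
    "Poly_Mapping.lookup (Poly_Mapping.single (vertex z) (Poly_Mapping.lookup m z)) i \<noteq> 0"
    unfolding vertex_degree_def lookup_sum by (meson sum.neutral)
  then have "vertex z = i" by (auto simp: lookup_single when_def split: if_splits)
  with z show ?thesis by (cases z) auto
qed

section \<open>Primality of the ideal of all two-by-two minors\<close>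

definition minor :: "'a \<Rightarrow> 'a \<Rightarrow> ('a, 'k::field) bpoly" where
  "minor i j = var_poly (X i) * var_poly (Y j) - var_poly (X j) * var_poly (Y i)"

lemma minor_self [simp]: "minor i i = 0"
  by (simp add: minor_def)

lemma minor_swap: "minor j i = - minor i j"
  by (simp add: minor_def)

lemma minor_closed: "i \<in> V \<Longrightarrow> j \<in> V \<Longrightarrow> minor i j \<in> carrier (poly_ring V)"
  by (simp add: minor_def poly_ring_closed)

lemma minor_eq:
  "minor i j =
     Poly_Mapping.single (Poly_Mapping.single (X i) 1 + Poly_Mapping.single (Y j) 1) 1 -
     Poly_Mapping.single (Poly_Mapping.single (X j) 1 + Poly_Mapping.single (Y i) 1) 1"
  by (simp add: minor_def var_poly_def mult_single)

text \<open>The straightening step: modulo the minors, any variable \<open>z\<close> that the degrees of \<open>m\<close> allow can be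
  made to divide \<open>m\<close>. If \<open>z = x\<^sub>i\<close> does not divide \<open>m\<close>, then \<open>y\<^sub>i\<close> does and some \<open>x\<^sub>j\<close> does, and
  \<open>x\<^sub>j y\<^sub>i\<close> may be replaced by \<open>x\<^sub>i y\<^sub>j\<close>; the case \<open>z = y\<^sub>i\<close> is symmetric.\<close>

lemma exchange_variable:
  fixes I :: "('a, 'k::field) bpoly set" and m :: "'a var \<Rightarrow>\<^sub>0 nat"
  assumes I: "ideal I (poly_ring V)"
    and minors: "\<And>i j. i \<in> V \<Longrightarrow> j \<in> V \<Longrightarrow> minor i j \<in> I"
    and m: "Poly_Mapping.keys m \<subseteq> X ` V \<union> Y ` V"
    and vertex: "Poly_Mapping.lookup (vertex_degree m) (vertex z) \<noteq> 0"
    and xdeg: "x_count z 1 \<le> x_degree m" and ydeg: "y_count z 1 \<le> y_degree m"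
  obtains n where "Poly_Mapping.keys n \<subseteq> X ` V \<union> Y ` V"
    and "vertex_degree m = vertex_degree (Poly_Mapping.single z 1 + n)"
    and "y_degree m = y_degree (Poly_Mapping.single z 1 + n)"
    and "Poly_Mapping.single m 1 - Poly_Mapping.single (Poly_Mapping.single z 1 + n) 1 \<in> I"
proof (cases "z \<in> Poly_Mapping.keys m")
  case True
  then obtain n where "m = Poly_Mapping.single z 1 + n"
    "Poly_Mapping.keys n \<subseteq> Poly_Mapping.keys m"
    by (rule nat_poly_mapping_split)
  then show thesis
    using that[of n] m poly_ring_idealD(2)[OF I] by auto
next
  case False
  note witness = that
  let ?x = "\<lambda>i. Poly_Mapping.single (X i) (1::nat)"
  let ?y = "\<lambda>i. Poly_Mapping.single (Y i) (1::nat)"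
  have swap: thesis if eq: "m = ?x i + (?y j + l)" and l: "Poly_Mapping.keys l \<subseteq> X ` V \<union> Y ` V"
    and ij: "i \<in> V" "j \<in> V" and z: "z = Y i \<or> z = X j" for i j l
  proof -
    have "minor i j * Poly_Mapping.single l 1 \<in> I"
      using l ij by (intro poly_ring_idealD(5)[OF I] minors) (auto simp: poly_ring_carrier_iff)
    then have in_I: "Poly_Mapping.single m 1 - Poly_Mapping.single (?y i + (?x j + l)) 1 \<in> I"
      by (simp add: minor_eq eq left_diff_distrib mult_single add_ac)
    have keys: "Poly_Mapping.keys (Poly_Mapping.single v 1 + l) \<subseteq> X ` V \<union> Y ` V"
      if "v \<in> X ` V \<union> Y ` V" for v :: "'a var"
      using keys_add[of "Poly_Mapping.single v 1" l] l that by auto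
    from z show thesis
    proof
      assume "z = Y i"
      then show thesis
        using in_I keys[of "X j"] ij
        by (intro witness[of "?x j + l"]) (auto simp: eq degree_add add_ac)
    next
      assume "z = X j"
      then show thesis
        using in_I keys[of "Y i"] ij
        by (intro witness[of "?y i + l"]) (auto simp: eq degree_add add_ac)
    qed
  qed
  have both: "\<exists>l. m = ?x i + (?y j + l) \<and> Poly_Mapping.keys l \<subseteq> X ` V \<union> Y ` V \<and> i \<in> V \<and> j \<in> V"
    if i: "X i \<in> Poly_Mapping.keys m" and j: "Y j \<in> Poly_Mapping.keys m" for i j
  proof -
    obtain k where k: "m = ?x i + k" "Poly_Mapping.keys k \<subseteq> Poly_Mapping.keys m"
      using i by (rule nat_poly_mapping_split)
    have "Y j \<in> Poly_Mapping.keys k"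
      using j by (auto simp: k(1) in_keys_iff lookup_add lookup_single)
    then obtain l where "k = ?y j + l" "Poly_Mapping.keys l \<subseteq> Poly_Mapping.keys k"
      by (rule nat_poly_mapping_split)
    with k i j m show ?thesis by auto
  qed
  show thesis
  proof (cases z)
    case (X i)
    then have "Y i \<in> Poly_Mapping.keys m"
      using vertex_degree_nonzeroD[OF vertex] False by auto
    moreover obtain j where "X j \<in> Poly_Mapping.keys m"
      by (rule x_degree_nonzeroD[of m]) (use xdeg X in auto)
    ultimately show thesis
      using both swap X by metis
  next
    case (Y i)
    then have "X i \<in> Poly_Mapping.keys m"
      using vertex_degree_nonzeroD[OF vertex] False by auto
    moreover obtain j where "Y j \<in> Poly_Mapping.keys m"
      by (rule y_degree_nonzeroD[of m]) (use ydeg Y in auto)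
    ultimately show thesis
      using both swap Y by metis
  qed
qed

text \<open>By induction on \<open>m'\<close>: each variable of \<open>m'\<close> is exchanged into \<open>m\<close> and then cancelled from both.\<close>

lemma monomials_congruent:
  fixes I :: "('a, 'k::field) bpoly set"
  assumes I: "ideal I (poly_ring V)"
    and minors: "\<And>i j. i \<in> V \<Longrightarrow> j \<in> V \<Longrightarrow> minor i j \<in> I"
    and "Poly_Mapping.keys m \<subseteq> X ` V \<union> Y ` V" "Poly_Mapping.keys m' \<subseteq> X ` V \<union> Y ` V"
    and "vertex_degree m = vertex_degree m'" "y_degree m = y_degree m'"
  shows "Poly_Mapping.single m 1 - Poly_Mapping.single m' 1 \<in> I"
  using assms(3-)
proof (induction m' arbitrary: m rule: nat_poly_mapping_induct)
  case zero
  then have "x_degree m + y_degree m = 0"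
    using x_degree_plus_y_degree[of m] by simp
  have "m = 0"
  proof (rule ccontr)
    assume "m \<noteq> 0"
    then obtain z n where "m = Poly_Mapping.single z 1 + n"
      by (rule nat_poly_mapping_nonzeroE)
    with \<open>x_degree m + y_degree m = 0\<close> show False
      by (cases z) (auto simp: degree_add)
  qed
  then show ?case using poly_ring_idealD(2)[OF I] by simp
next
  case (single z n')
  have "x_degree m = x_degree (Poly_Mapping.single z 1 + n')"
    using x_degree_plus_y_degree[of m] x_degree_plus_y_degree[of "Poly_Mapping.single z 1 + n'"]
      single.prems by simp
  then have "Poly_Mapping.lookup (vertex_degree m) (vertex z) \<noteq> 0"
    "x_count z 1 \<le> x_degree m" "y_count z 1 \<le> y_degree m"
    using single.prems by (simp_all add: degree_add lookup_add)
  with I minors single.prems(1) obtain n where n: "Poly_Mapping.keys n \<subseteq> X ` V \<union> Y ` V"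
    "vertex_degree m = vertex_degree (Poly_Mapping.single z 1 + n)"
    "y_degree m = y_degree (Poly_Mapping.single z 1 + n)"
    "Poly_Mapping.single m 1 - Poly_Mapping.single (Poly_Mapping.single z 1 + n) 1 \<in> I"
    by (rule exchange_variable)
  have keys: "Poly_Mapping.keys (Poly_Mapping.single z 1 + n') =
      insert z (Poly_Mapping.keys n')"
    by (auto simp: in_keys_iff lookup_add lookup_single when_def split: if_splits)
  have "Poly_Mapping.single n 1 - Poly_Mapping.single n' 1 \<in> I"
    using single n keys by (intro single.IH) (auto simp: degree_add)
  then have "Poly_Mapping.single (Poly_Mapping.single z 1) 1 *
      (Poly_Mapping.single n 1 - Poly_Mapping.single n' 1) \<in> I"
    using single.prems(2) keys
    by (intro poly_ring_idealD(4)[OF I]) (auto simp: poly_ring_carrier_iff)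
  then have "Poly_Mapping.single (Poly_Mapping.single z 1 + n) 1 -
      Poly_Mapping.single (Poly_Mapping.single z 1 + n') 1 \<in> I"
    by (simp add: right_diff_distrib mult_single)
  from poly_ring_idealD(3)[OF I n(4) this] show ?case by simp
qed

text \<open>The homomorphism \<open>x\<^sub>i \<mapsto> a\<^sub>i\<close>, \<open>y\<^sub>i \<mapsto> a\<^sub>i t\<close>, obtained by setting \<open>s = 1\<close> in the parametrisation
  \<open>x\<^sub>i \<mapsto> a\<^sub>i s\<close>, \<open>y\<^sub>i \<mapsto> a\<^sub>i t\<close> of the two-rowed matrices of rank at most one. The \<open>a\<^sub>i\<close> are the outer
  variables, and \<open>t\<close> is the variable of the coefficient ring.\<close>

interpretation segre: term_hom
  "\<lambda>m a. Poly_Mapping.single (vertex_degree m) (monom a (y_degree m))"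
  by unfold_locales
    (simp_all add: degree_add add_monom mult_single mult_monom monom_eq_1 flip: single_add)

abbreviation segre :: "('a, 'k::field) bpoly \<Rightarrow> ('a \<Rightarrow>\<^sub>0 nat) \<Rightarrow>\<^sub>0 'k poly" where
  "segre \<equiv> segre.ext"

lemma coeff_segre:
  "coeff (Poly_Mapping.lookup (segre p) g) b =
     (\<Sum>m | m \<in> Poly_Mapping.keys p \<and> (vertex_degree m, y_degree m) = (g, b).
        Poly_Mapping.lookup p m)"
proof -
  have "coeff (Poly_Mapping.lookup (segre p) g) b = (\<Sum>m\<in>Poly_Mapping.keys p.
      if (vertex_degree m, y_degree m) = (g, b) then Poly_Mapping.lookup p m else 0)"
    unfolding segre.ext_def lookup_sum coeff_sum
    by (intro sum.cong) (auto simp: lookup_single when_def)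
  then show ?thesis
    by (simp add: sum.If_cases Int_def)
qed

lemma segre_minor [simp]: "segre (minor i j) = 0"
  by (simp add: minor_eq segre.ext_diff degree_add add.commute)

lemma segre_var [simp]: "segre (var_poly z) \<noteq> 0"
  by (simp add: var_poly_def single_eq_zero_iff)

definition segre_kernel :: "'a set \<Rightarrow> ('a, 'k::field) bpoly set" where
  "segre_kernel V = {p \<in> carrier (poly_ring V). segre p = 0}"

lemma segre_kernel_ideal: "ideal (segre_kernel V) (poly_ring V)"
  by (rule poly_ring_idealI)
    (auto simp: segre_kernel_def poly_ring_closed segre.ext_add segre.ext_mult)

text \<open>The target of \<open>segre\<close> is an integral domain: a linear order on the vertices makes the outer monomials
  an ordered monoid, and leading terms cannot cancel.\<close>

lemma segre_kernel_prime:
  "primeideal (segre_kernel V :: ('a::linorder, 'k::field) bpoly set) (poly_ring V)"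
proof (rule primeidealI)
  show "carrier (poly_ring V) \<noteq> segre_kernel V"
  proof -
    have "1 \<in> carrier (poly_ring V) - segre_kernel V"
      by (simp add: segre_kernel_def poly_ring_closed)
    then show ?thesis by blast
  qed
next
  fix p q :: "('a, 'k) bpoly"
  assume "p \<in> carrier (poly_ring V)" "q \<in> carrier (poly_ring V)"
    "p \<otimes>\<^bsub>poly_ring V\<^esub> q \<in> segre_kernel V"
  then show "p \<in> segre_kernel V \<or> q \<in> segre_kernel V"
    by (auto simp: segre_kernel_def segre.ext_mult)
qed (rule segre_kernel_ideal poly_ring_cring)+

text \<open>Among the monomials of \<open>p\<close> with a given image under \<open>segre\<close>, choose one. Replacing every monomial of
  \<open>p\<close> by the chosen one changes \<open>p\<close> only by an element of \<open>I\<close>, and the result is zero, since its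
  coefficients are those of \<open>segre p\<close>.\<close>

lemma segre_kernel_subset:
  fixes I :: "('a, 'k::field) bpoly set"
  assumes I: "ideal I (poly_ring V)"
    and minors: "\<And>i j. i \<in> V \<Longrightarrow> j \<in> V \<Longrightarrow> minor i j \<in> I"
  shows "segre_kernel V \<subseteq> I"
proof
  fix p :: "('a, 'k) bpoly"
  assume "p \<in> segre_kernel V"
  then have p: "p \<in> carrier (poly_ring V)" and ker: "segre p = 0"
    by (simp_all add: segre_kernel_def)
  let ?K = "Poly_Mapping.keys p" and ?c = "Poly_Mapping.lookup p"
  define sig :: "('a var \<Rightarrow>\<^sub>0 nat) \<Rightarrow> _" where "sig m = (vertex_degree m, y_degree m)" for m
  define rep where "rep s = (SOME m. m \<in> ?K \<and> sig m = s)" for s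
  have rep: "rep (sig m) \<in> ?K \<and> sig (rep (sig m)) = sig m" if "m \<in> ?K" for m
    unfolding rep_def by (rule someI[of _ m]) (use that in simp)
  have "(\<Sum>m\<in>?K. Poly_Mapping.single (rep (sig m)) (?c m)) =
      (\<Sum>s\<in>sig ` ?K. \<Sum>m | m \<in> ?K \<and> sig m = s. Poly_Mapping.single (rep (sig m)) (?c m))"
    by (rule sum.image_gen) simp
  also have "\<dots> = (\<Sum>s\<in>sig ` ?K. Poly_Mapping.single (rep s) (\<Sum>m | m \<in> ?K \<and> sig m = s. ?c m))"
    by (intro sum.cong refl) (simp add: single_sum)
  also have "\<dots> = 0"
  proof (rule sum.neutral, rule ballI)
    fix s
    have "(\<Sum>m | m \<in> ?K \<and> sig m = s. ?c m) = coeff (Poly_Mapping.lookup (segre p) (fst s)) (snd s)"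
      by (cases s) (simp add: coeff_segre sig_def)
    then show "Poly_Mapping.single (rep s) (\<Sum>m | m \<in> ?K \<and> sig m = s. ?c m) = 0"
      by (simp add: ker)
  qed
  finally have "p = (\<Sum>m\<in>?K. Poly_Mapping.single m (?c m)) -
      (\<Sum>m\<in>?K. Poly_Mapping.single (rep (sig m)) (?c m))"
    by (simp flip: poly_mapping_eq_sum_single)
  also have "\<dots> = (\<Sum>m\<in>?K. Poly_Mapping.single 0 (?c m) *
      (Poly_Mapping.single m 1 - Poly_Mapping.single (rep (sig m)) 1))"
    by (simp add: sum_subtractf right_diff_distrib mult_single)
  also have "\<dots> \<in> I"
  proof (rule poly_ring_ideal_sum[OF I])
    fix m assume m: "m \<in> ?K"
    have "Poly_Mapping.single m 1 - Poly_Mapping.single (rep (sig m)) 1 \<in> I"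
      using rep[OF m] m p
      by (intro monomials_congruent[OF I minors]) (auto simp: poly_ring_carrier_iff sig_def)
    then show "Poly_Mapping.single 0 (?c m) *
        (Poly_Mapping.single m 1 - Poly_Mapping.single (rep (sig m)) 1) \<in> I"
      by (rule poly_ring_idealD(4)[OF I]) (simp add: poly_ring_carrier_iff)
  qed
  finally show "p \<in> I" .
qed

section \<open>Evaluation at points\<close>

definition mon_eval :: "('z \<Rightarrow> 'k::field) \<Rightarrow> ('z \<Rightarrow>\<^sub>0 nat) \<Rightarrow> 'k" where
  "mon_eval c m = (\<Prod>z\<in>Poly_Mapping.keys m. c z ^ Poly_Mapping.lookup m z)"

lemma mon_eval_superset:
  assumes "finite A" "Poly_Mapping.keys m \<subseteq> A"
  shows "mon_eval c m = (\<Prod>z\<in>A. c z ^ Poly_Mapping.lookup m z)"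
  unfolding mon_eval_def
  by (rule prod.mono_neutral_left) (use assms in \<open>auto simp: in_keys_iff\<close>)

lemma mon_eval_add: "mon_eval c (m + n) = mon_eval c m * mon_eval c n"
proof -
  let ?A = "Poly_Mapping.keys m \<union> Poly_Mapping.keys n"
  have "mon_eval c m = (\<Prod>z\<in>?A. c z ^ Poly_Mapping.lookup m z)"
    "mon_eval c n = (\<Prod>z\<in>?A. c z ^ Poly_Mapping.lookup n z)"
    "mon_eval c (m + n) = (\<Prod>z\<in>?A. c z ^ Poly_Mapping.lookup (m + n) z)"
    using keys_add[of m n] by (simp_all add: mon_eval_superset)
  then show ?thesis
    by (simp add: lookup_add power_add prod.distrib)
qed

lemma mon_eval_zero [simp]: "mon_eval c 0 = 1"
  and mon_eval_single [simp]: "mon_eval c (Poly_Mapping.single z 1) = c z"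
  by (simp_all add: mon_eval_def)

interpretation eval: term_hom "\<lambda>m a. a * mon_eval c m" for c
  by unfold_locales (simp_all add: mon_eval_add algebra_simps)

abbreviation eval_at :: "('z \<Rightarrow> 'k::field) \<Rightarrow> (('z \<Rightarrow>\<^sub>0 nat) \<Rightarrow>\<^sub>0 'k) \<Rightarrow> 'k" where
  "eval_at \<equiv> eval.ext"

lemma eval_minor: "eval_at c (minor i j) = c (X i) * c (Y j) - c (X j) * c (Y i)"
  by (simp add: minor_def var_poly_def eval.ext_diff eval.ext_mult del: One_nat_def)

lemma graded_component_1_keys:
  assumes "f \<in> graded_component V 1" "m \<in> Poly_Mapping.keys f"
  obtains z where "m = Poly_Mapping.single z 1" "vertex z \<in> V"
proof -
  obtain z where z: "m = Poly_Mapping.single z 1"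
    using assms mon_degree_eq_1E[of m] by (auto simp: graded_component_def)
  have "Poly_Mapping.keys m \<subseteq> X ` V \<union> Y ` V"
    using assms unfolding graded_component_def poly_ring_carrier_iff by blast
  then have "vertex z \<in> V"
    using z by auto
  with z show thesis by (rule that)
qed

lemma eval_linear_form_add:
  assumes f: "f \<in> graded_component V 1"
  shows "eval_at (\<lambda>z. c z + d z) f = eval_at c f + eval_at d f"
  unfolding eval.ext_def sum.distrib[symmetric]
proof (rule sum.cong)
  fix m assume "m \<in> Poly_Mapping.keys f"
  with f obtain z where "m = Poly_Mapping.single z 1"
    by (rule graded_component_1_keys)
  then show "Poly_Mapping.lookup f m * mon_eval (\<lambda>z. c z + d z) m =
      Poly_Mapping.lookup f m * mon_eval c m + Poly_Mapping.lookup f m * mon_eval d m"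
    by (simp add: distrib_left del: One_nat_def)
qed simp

text \<open>Together with \<open>eval_linear_form_add\<close>, this recovers a coefficient of a linear form as the difference
  of two of its values.\<close>

lemma eval_linear_form_unit_vector:
  assumes f: "f \<in> graded_component V 1"
  shows "eval_at (\<lambda>y. of_bool (y = z)) f = Poly_Mapping.lookup f (Poly_Mapping.single z 1)"
proof -
  have "eval_at (\<lambda>y. of_bool (y = z)) f = (\<Sum>m\<in>Poly_Mapping.keys f.
      if m = Poly_Mapping.single z 1 then Poly_Mapping.lookup f m else 0)"
    unfolding eval.ext_def
  proof (rule sum.cong)
    fix m assume "m \<in> Poly_Mapping.keys f"
    with f obtain y where y: "m = Poly_Mapping.single y 1"
      by (rule graded_component_1_keys)
    moreover have "m = Poly_Mapping.single z 1 \<longleftrightarrow> y = z"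
      by (simp add: y single_eq_single_iff)
    ultimately show "Poly_Mapping.lookup f m * mon_eval (\<lambda>y. of_bool (y = z)) m =
        (if m = Poly_Mapping.single z 1 then Poly_Mapping.lookup f m else 0)"
      by (simp del: One_nat_def)
  qed simp
  then show ?thesis
    by (simp add: in_keys_iff)
qed

text \<open>Within degree zero and within degree one, distinct monomials have distinct images, so nothing can
  cancel. In degree two this fails, as the minors show.\<close>

lemma segre_low_degree_nonzero:
  assumes f: "f \<in> graded_component V d" and d: "d \<le> 1" and "f \<noteq> 0"
  shows "segre f \<noteq> 0"
proof
  assume zero: "segre f = 0"
  from \<open>f \<noteq> 0\<close> obtain m where m: "m \<in> Poly_Mapping.keys f"
    by (metis keys_eq_empty equals0I)
  have "n = m" if n: "n \<in> Poly_Mapping.keys f"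
    and "vertex_degree n = vertex_degree m" "y_degree n = y_degree m" for n
  proof -
    have deg: "mon_degree n = d" "mon_degree m = d"
      using f m n by (auto simp: graded_component_def)
    show ?thesis
    proof (cases "d = 0")
      case True
      then show ?thesis using deg mon_degree_eq_0D by metis
    next
      case False
      then have "mon_degree n = 1" "mon_degree m = 1"
        using deg d by auto
      then obtain y z where "n = Poly_Mapping.single y 1" "m = Poly_Mapping.single z 1"
        by (meson mon_degree_eq_1E)
      then show ?thesis
        using that by (cases y; cases z) (auto simp: single_eq_single_iff)
    qed
  qed
  then have "{n. n \<in> Poly_Mapping.keys f \<and>
      (vertex_degree n, y_degree n) = (vertex_degree m, y_degree m)} = {m}"
    using m by auto
  then have "coeff (Poly_Mapping.lookup (segre f) (vertex_degree m)) (y_degree m) =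
      Poly_Mapping.lookup f m"
    unfolding coeff_segre by simp
  with zero m show False
    by (simp add: in_keys_iff)
qed

section \<open>Binomial edge ideals\<close>

lemma edge_endpoints:
  assumes "simple_graph G" "{i, j} \<in> edges G"
  shows "i \<in> verts G" "j \<in> verts G" "i \<noteq> j"
  using assms unfolding simple_graph_def by force+

lemma binomial_edge_ideal_minors:
  "binomial_edge_ideal G =
     Idl\<^bsub>poly_ring (verts G)\<^esub> {minor i j | i j. {i, j} \<in> edges G \<and> i < j}"
  by (simp add: binomial_edge_ideal_def minor_def)

lemma edge_ideal_is_ideal:
  assumes "simple_graph G"
  shows "ideal (binomial_edge_ideal G) (poly_ring (verts G))"
proof -
  interpret cring "poly_ring (verts G)" by (rule poly_ring_cring)
  show ?thesis
    unfolding binomial_edge_ideal_minors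
    by (rule genideal_ideal) (auto intro: minor_closed edge_endpoints[OF assms])
qed

lemma edge_minor_in_edge_ideal:
  assumes G: "simple_graph G" and ij: "{i, j} \<in> edges G"
  shows "minor i j \<in> binomial_edge_ideal G"
proof -
  interpret cring "poly_ring (verts G)" by (rule poly_ring_cring)
  have less: "minor i j \<in> binomial_edge_ideal G" if "i < j" "{i, j} \<in> edges G" for i j
    unfolding binomial_edge_ideal_minors
    by (rule subsetD[OF genideal_self]) (use that in \<open>auto intro: minor_closed edge_endpoints[OF G]\<close>)
  show ?thesis
  proof (cases i j rule: linorder_cases)
    case greater
    then have "minor j i \<in> binomial_edge_ideal G"
      using ij by (intro less) (auto simp: insert_commute)
    then show ?thesis
      unfolding minor_swap[of i j] by (rule poly_ring_idealD(6)[OF edge_ideal_is_ideal[OF G]])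
  qed (use less ij edge_endpoints(3)[OF G ij] in auto)
qed

lemma edge_ideal_subset:
  assumes "ideal I (poly_ring (verts G))"
    and "\<And>i j. {i, j} \<in> edges G \<Longrightarrow> minor i j \<in> I"
  shows "binomial_edge_ideal G \<subseteq> I"
proof -
  interpret cring "poly_ring (verts G)" by (rule poly_ring_cring)
  show ?thesis
    unfolding binomial_edge_ideal_minors
    by (rule genideal_minimal) (use assms in auto)
qed

lemma edge_ideal_subset_segre_kernel:
  assumes "simple_graph G"
  shows "binomial_edge_ideal G \<subseteq> segre_kernel (verts G)"
proof (rule edge_ideal_subset[OF segre_kernel_ideal])
  fix i j assume "{i, j} \<in> edges G"
  then show "minor i j \<in> segre_kernel (verts G)"
    using edge_endpoints[OF assms] by (simp add: segre_kernel_def minor_closed)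
qed

lemma eval_edge_ideal_zero:
  assumes G: "simple_graph G" and p: "p \<in> binomial_edge_ideal G"
    and c: "\<And>i j. {i, j} \<in> edges G \<Longrightarrow> c (X i) * c (Y j) = c (X j) * c (Y i)"
  shows "eval_at c p = 0"
proof -
  let ?I = "{p \<in> carrier (poly_ring (verts G)). eval_at c p = 0}"
  have "binomial_edge_ideal G \<subseteq> ?I"
  proof (rule edge_ideal_subset)
    show "ideal ?I (poly_ring (verts G))"
      by (rule poly_ring_idealI) (auto simp: poly_ring_closed eval.ext_add eval.ext_mult)
  next
    fix i j assume ij: "{i, j} \<in> edges G"
    then show "minor i j \<in> ?I"
      using edge_endpoints[OF G ij] c[OF ij] by (simp add: minor_closed eval_minor)
  qed
  with p show ?thesis by blast
qed

text \<open>Every edge has an endpoint outside \<open>{v, w}\<close>, where \<open>c\<close> is zero, and both terms of its binomial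
  contain a variable of that endpoint.\<close>

lemma eval_edge_ideal_nonadjacent:
  assumes G: "simple_graph G" and "p \<in> binomial_edge_ideal G" and vw: "{v, w} \<notin> edges G"
    and supp: "\<And>z. vertex z \<notin> {v, w} \<Longrightarrow> c z = 0"
  shows "eval_at c p = 0"
  using assms(1,2)
proof (rule eval_edge_ideal_zero)
  fix i j assume ij: "{i, j} \<in> edges G"
  have "i \<notin> {v, w} \<or> j \<notin> {v, w}"
    using ij vw edge_endpoints(3)[OF G ij] by (auto simp: insert_commute)
  then show "c (X i) * c (Y j) = c (X j) * c (Y i)"
    using supp[of "X i"] supp[of "Y i"] supp[of "X j"] supp[of "Y j"] by auto
qed

text \<open>At points supported on \<open>v\<close> and \<open>w\<close> where the minor is nonzero, \<open>f\<close> must vanish. Two such points that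
  differ only in one coordinate at \<open>v\<close> show that the coefficient of that coordinate is zero. All
  coordinates of these points are zero or one, so the argument works over every field.\<close>

lemma nonadjacent_coefficients_zero:
  fixes f :: "('a::linorder, 'k::field) bpoly"
  assumes G: "simple_graph G" and vw: "v \<noteq> w" "{v, w} \<notin> edges G"
    and f: "f \<in> graded_component (verts G) 1"
    and in_J: "minor v w * f \<in> binomial_edge_ideal G"
  shows "Poly_Mapping.lookup f (Poly_Mapping.single (X v) 1) = 0"
    and "Poly_Mapping.lookup f (Poly_Mapping.single (Y v) 1) = 0"
proof -
  have zero: "eval_at c f = 0"
    if "\<And>z. vertex z \<notin> {v, w} \<Longrightarrow> c z = 0" "c (X v) * c (Y w) \<noteq> c (X w) * c (Y v)"
    for c :: "'a var \<Rightarrow> 'k"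
  proof -
    have "eval_at c (minor v w * f) = 0"
      by (rule eval_edge_ideal_nonadjacent[OF G in_J vw(2)]) (rule that(1))
    with that(2) show ?thesis
      by (simp add: eval.ext_mult eval_minor)
  qed
  \<comment> \<open>The two points are \<open>c\<close> and the sum of \<open>c\<close> and the unit vector of \<open>u\<close>.\<close>
  have coeff: "Poly_Mapping.lookup f (Poly_Mapping.single u 1) = 0"
    if c: "\<And>z. vertex z \<notin> {v, w} \<Longrightarrow> c z = 0" and u: "vertex u = v"
      and det: "c (X v) * c (Y w) \<noteq> c (X w) * c (Y v)"
      "(c (X v) + of_bool (X v = u)) * c (Y w) \<noteq> c (X w) * (c (Y v) + of_bool (Y v = u))"
    for c :: "'a var \<Rightarrow> 'k" and u
  proof -
    have "eval_at (\<lambda>z. c z + of_bool (z = u)) f = 0"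
      by (rule zero) (use c u det vw(1) in auto)
    then show ?thesis
      using zero[OF c det(1)]
      by (simp add: eval_linear_form_add[OF f] eval_linear_form_unit_vector[OF f] del: One_nat_def)
  qed
  show "Poly_Mapping.lookup f (Poly_Mapping.single (X v) 1) = 0"
    by (rule coeff[of "\<lambda>z. of_bool (z = Y v \<or> z = X w)"]) (use vw(1) in auto)
  show "Poly_Mapping.lookup f (Poly_Mapping.single (Y v) 1) = 0"
    by (rule coeff[of "\<lambda>z. of_bool (z = X v \<or> z = Y w)"]) (use vw(1) in auto)
qed

text \<open>A prime ideal inside the kernel contains no variable, so the identity
  \<open>x\<^sub>w [u,x] = x\<^sub>u [w,x] + x\<^sub>x [u,w]\<close> extends a path from \<open>u\<close> to \<open>w\<close> by the edge \<open>{w, x}\<close>.\<close>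

lemma primeideal_contains_minors:
  assumes G: "simple_graph G" "connected_graph G"
    and P: "primeideal P (poly_ring (verts G))"
    and J_P: "binomial_edge_ideal G \<subseteq> P" and P_ker: "P \<subseteq> segre_kernel (verts G)"
    and u: "u \<in> verts G" and w: "w \<in> verts G"
  shows "minor u w \<in> P"
proof -
  interpret primeideal P "poly_ring (verts G)" by fact
  note P_ideal = poly_ring_idealD[OF ideal_axioms]
  have "(u, w) \<in> (adj_rel G)\<^sup>*"
    using G(2) u w by (auto simp: connected_graph_def)
  then show ?thesis
  proof (induction rule: rtrancl_induct)
    case base
    then show ?case using P_ideal(2) by simp
  next
    case (step w x)
    then have wx: "{w, x} \<in> edges G" by (simp add: adj_rel_def)
    note ends = edge_endpoints[OF G(1) wx]
    have "var_poly (X w) * minor u x =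
        var_poly (X u) * minor w x + var_poly (X x) * minor u w"
      by (simp add: minor_def algebra_simps)
    also have "\<dots> \<in> P"
      using edge_minor_in_edge_ideal[OF G(1) wx] J_P step.IH u ends
      by (intro P_ideal(3) P_ideal(4)) (auto intro: poly_ring_closed)
    finally have "var_poly (X w) \<in> P \<or> minor u x \<in> P"
      using I_prime[of "var_poly (X w)" "minor u x"] u ends
      by (simp add: poly_ring_closed minor_closed)
    moreover have "var_poly (X w) \<notin> P"
      using P_ker by (auto simp: segre_kernel_def)
    ultimately show ?case by simp
  qed
qed

lemma colon_zero_not_prime:
  assumes "ideal I (poly_ring V)" "primeideal (colon (poly_ring V) I f) (poly_ring V)"
  shows "f \<noteq> 0"
proof
  assume "f = 0"
  then have "colon (poly_ring V) I f = carrier (poly_ring V)"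
    using poly_ring_idealD(2)[OF assms(1)] by (auto simp: colon_def)
  with assms(2) show False using primeideal.I_notcarr by blast
qed

lemma colon_subset_segre_kernel:
  assumes "simple_graph G" and "segre f \<noteq> 0"
  shows "colon (poly_ring (verts G)) (binomial_edge_ideal G) f \<subseteq> segre_kernel (verts G)"
  using edge_ideal_subset_segre_kernel[OF assms(1)] assms(2)
  by (auto simp: colon_def segre_kernel_def segre.ext_mult dest!: subsetD)

text \<open>The bound on the degree ensures \<open>segre f \<noteq> 0\<close>, hence that the colon ideal lies in the kernel.\<close>

lemma low_degree_times_minor_in_edge_ideal:
  assumes G: "simple_graph G" "connected_graph G"
    and f: "f \<in> graded_component (verts G) d" and d: "d \<le> 1"
    and P: "primeideal (colon (poly_ring (verts G)) (binomial_edge_ideal G) f) (poly_ring (verts G))"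
    and "u \<in> verts G" "w \<in> verts G"
  shows "minor u w * f \<in> binomial_edge_ideal G"
proof -
  let ?R = "poly_ring (verts G)" and ?J = "binomial_edge_ideal G"
  note J = poly_ring_idealD[OF edge_ideal_is_ideal[OF G(1)]]
  have f_closed: "f \<in> carrier ?R"
    using f by (simp add: graded_component_def)
  have "f \<noteq> 0"
    using edge_ideal_is_ideal[OF G(1)] P by (rule colon_zero_not_prime)
  then have "segre f \<noteq> 0"
    using f d by (intro segre_low_degree_nonzero)
  then have "colon ?R ?J f \<subseteq> segre_kernel (verts G)"
    by (rule colon_subset_segre_kernel[OF G(1)])
  moreover have "?J \<subseteq> colon ?R ?J f"
    using J f_closed by (auto simp: colon_def)
  ultimately have "minor u w \<in> colon ?R ?J f"
    using primeideal_contains_minors[OF G P] assms(6,7) by blast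
  then show ?thesis
    by (simp add: colon_def)
qed

lemma edge_ideal_complete:
  assumes "simple_graph G" "complete_graph G"
  shows "binomial_edge_ideal G = segre_kernel (verts G)"
proof
  show "segre_kernel (verts G) \<subseteq> binomial_edge_ideal G"
  proof (rule segre_kernel_subset[OF edge_ideal_is_ideal[OF assms(1)]])
    fix i j assume "i \<in> verts G" "j \<in> verts G"
    then show "minor i j \<in> binomial_edge_ideal G"
      using assms poly_ring_idealD(2)[OF edge_ideal_is_ideal[OF assms(1)]]
      by (cases "i = j") (auto simp: complete_graph_def intro: edge_minor_in_edge_ideal)
  qed
qed (rule edge_ideal_subset_segre_kernel[OF assms(1)])

lemma colon_eq_segre_kernel:
  fixes f :: "('a::linorder, 'k::field) bpoly"
  assumes G: "simple_graph G" and f: "f \<in> carrier (poly_ring (verts G))" "segre f \<noteq> 0"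
    and minors: "\<And>u w. u \<in> verts G \<Longrightarrow> w \<in> verts G \<Longrightarrow> minor u w * f \<in> binomial_edge_ideal G"
  shows "colon (poly_ring (verts G)) (binomial_edge_ideal G) f = segre_kernel (verts G)"
    (is "?C = _")
proof
  note J = poly_ring_idealD[OF edge_ideal_is_ideal[OF G]]
  show "?C \<subseteq> segre_kernel (verts G)"
    using G f(2) by (rule colon_subset_segre_kernel)
  show "segre_kernel (verts G) \<subseteq> ?C"
  proof (rule segre_kernel_subset)
    show "ideal ?C (poly_ring (verts G))"
      by (rule poly_ring_idealI) (auto simp: colon_def J poly_ring_closed distrib_right mult.assoc)
  qed (simp add: colon_def minor_closed minors)
qed

lemma colon_dominating_vertex:
  assumes G: "simple_graph G" and v: "v \<in> verts G"
    and dom: "\<And>u. u \<in> verts G \<Longrightarrow> u \<noteq> v \<Longrightarrow> {u, v} \<in> edges G"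
  shows "colon (poly_ring (verts G)) (binomial_edge_ideal G) (var_poly (X v)) =
    segre_kernel (verts G)"
proof (rule colon_eq_segre_kernel[OF G])
  note J = poly_ring_idealD[OF edge_ideal_is_ideal[OF G]]
  show "var_poly (X v) \<in> carrier (poly_ring (verts G))"
    using v by (rule poly_ring_closed)
  have minor_v: "minor u v \<in> binomial_edge_ideal G" if "u \<in> verts G" for u
    using that J(2) by (cases "u = v") (auto intro: edge_minor_in_edge_ideal[OF G] dom)
  fix u w assume uw: "u \<in> verts G" "w \<in> verts G"
  have "minor u w * var_poly (X v) =
      var_poly (X w) * minor u v + - (var_poly (X u) * minor w v)"
    by (simp add: minor_def algebra_simps)
  also have "\<dots> \<in> binomial_edge_ideal G"
    using uw by (intro J(3,4,6) minor_v) (auto intro: poly_ring_closed)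
  finally show "minor u w * var_poly (X v) \<in> binomial_edge_ideal G" .
qed simp

text \<open>The identity of \<open>primeideal_contains_minors\<close> again: instead of being divided out, the factors \<open>x\<^sub>w\<close>
  met along the path accumulate in \<open>m\<close>.\<close>

lemma monomial_times_minor_in_edge_ideal:
  fixes G :: "'a::linorder graph"
  assumes G: "simple_graph G" "connected_graph G" and u: "u \<in> verts G" and w: "w \<in> verts G"
  shows "\<exists>m. Poly_Mapping.keys m \<subseteq> X ` verts G \<union> Y ` verts G \<and>
    minor u w * Poly_Mapping.single m 1 \<in> (binomial_edge_ideal G :: ('a, 'k::field) bpoly set)"
proof -
  let ?J = "binomial_edge_ideal G :: ('a, 'k) bpoly set"
  note J = poly_ring_idealD[OF edge_ideal_is_ideal[OF G(1)]]
  have "(u, w) \<in> (adj_rel G)\<^sup>*"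
    using G(2) u w by (auto simp: connected_graph_def)
  then show ?thesis
  proof (induction rule: rtrancl_induct)
    case base
    have "minor u u * Poly_Mapping.single 0 1 \<in> ?J"
      by (simp add: J(2))
    then show ?case by (intro exI[of _ 0]) simp
  next
    case (step w x)
    then have wx: "{w, x} \<in> edges G" by (simp add: adj_rel_def)
    note ends = edge_endpoints[OF G(1) wx]
    from step.IH obtain m where m: "Poly_Mapping.keys m \<subseteq> X ` verts G \<union> Y ` verts G"
      "minor u w * Poly_Mapping.single m 1 \<in> ?J"
      by blast
    let ?n = "Poly_Mapping.single (X w) 1 + m"
    have "(minor u x :: ('a, 'k) bpoly) * Poly_Mapping.single ?n 1 =
        minor u x * var_poly (X w) * Poly_Mapping.single m 1"
      by (simp only: var_poly_def mult.assoc mult_single mult_1)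
    also have "\<dots> = minor w x * (var_poly (X u) * Poly_Mapping.single m 1) +
        var_poly (X x) * (minor u w * Poly_Mapping.single m 1)"
      by (simp add: minor_def algebra_simps)
    also have "\<dots> \<in> ?J"
    proof (rule J(3))
      have "(Poly_Mapping.single m 1 :: ('a, 'k) bpoly) \<in> carrier (poly_ring (verts G))"
        using m(1) by (simp add: poly_ring_carrier_iff)
      then show "minor w x * (var_poly (X u) * Poly_Mapping.single m 1) \<in> ?J"
        using u by (intro J(5)[OF edge_minor_in_edge_ideal[OF G(1) wx]] poly_ring_closed)
      show "var_poly (X x) * (minor u w * Poly_Mapping.single m 1) \<in> ?J"
        using ends(2) by (intro J(4)[OF m(2)] poly_ring_closed)
    qed
    finally have "minor u x * Poly_Mapping.single ?n 1 \<in> ?J" .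
    moreover have "Poly_Mapping.keys ?n \<subseteq> X ` verts G \<union> Y ` verts G"
      using keys_add[of "Poly_Mapping.single (X w) 1" m] m(1) ends(1) by auto
    ultimately show ?case by blast
  qed
qed

text \<open>The product of the monomials for all pairs of vertices multiplies every minor into the edge ideal,
  but does not itself lie in the kernel.\<close>

lemma ex_colon_monomial_eq_segre_kernel:
  fixes G :: "'a::linorder graph"
  assumes fin: "finite (verts G)" and G: "simple_graph G" "connected_graph G"
  shows "\<exists>m. (Poly_Mapping.single m 1 :: ('a, 'k::field) bpoly) \<in> carrier (poly_ring (verts G)) \<and>
    colon (poly_ring (verts G)) (binomial_edge_ideal G)
      (Poly_Mapping.single m 1 :: ('a, 'k) bpoly) = segre_kernel (verts G)"
proof -
  let ?V = "verts G" and ?J = "binomial_edge_ideal G :: ('a, 'k) bpoly set"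
  let ?vars = "X ` ?V \<union> Y ` ?V"
  note J = poly_ring_idealD[OF edge_ideal_is_ideal[OF G(1)]]
  have "\<forall>p\<in>?V \<times> ?V. \<exists>m. Poly_Mapping.keys m \<subseteq> ?vars \<and>
      minor (fst p) (snd p) * Poly_Mapping.single m 1 \<in> ?J"
    using monomial_times_minor_in_edge_ideal[OF G] by auto
  then obtain m where m: "\<And>p. p \<in> ?V \<times> ?V \<Longrightarrow> Poly_Mapping.keys (m p) \<subseteq> ?vars"
    "\<And>p. p \<in> ?V \<times> ?V \<Longrightarrow> minor (fst p) (snd p) * Poly_Mapping.single (m p) 1 \<in> ?J"
    by metis
  have keys: "Poly_Mapping.keys (sum m A) \<subseteq> ?vars" if "A \<subseteq> ?V \<times> ?V" for A
    using keys_sum[of m A] that m(1) by blast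
  let ?f = "Poly_Mapping.single (sum m (?V \<times> ?V)) 1 :: ('a, 'k) bpoly"
  have f: "?f \<in> carrier (poly_ring ?V)"
    using keys[OF order_refl] by (simp add: poly_ring_carrier_iff)
  have "colon (poly_ring ?V) ?J ?f = segre_kernel ?V"
  proof (rule colon_eq_segre_kernel[OF G(1) f])
    show "segre ?f \<noteq> 0"
      by (simp add: single_eq_zero_iff)
    fix u w assume uw: "u \<in> ?V" "w \<in> ?V"
    let ?A = "?V \<times> ?V - {(u, w)}"
    have "sum m (?V \<times> ?V) = m (u, w) + sum m ?A"
      using fin uw by (intro sum.remove) auto
    then have "minor u w * ?f =
        minor u w * Poly_Mapping.single (m (u, w)) 1 * Poly_Mapping.single (sum m ?A) 1"
      by (simp add: mult.assoc mult_single)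
    also have "\<dots> \<in> ?J"
      using m(2)[of "(u, w)"] uw keys[of ?A]
      by (intro J(5)[where p = "minor u w * Poly_Mapping.single (m (u, w)) 1"])
        (auto simp: poly_ring_carrier_iff)
    finally show "minor u w * ?f \<in> ?J" .
  qed
  with f show ?thesis by blast
qed

section \<open>Cones and the v-number\<close>

text \<open>The form \<open>f\<close> guarantees that the infimum is taken over a nonempty set and is therefore attained.\<close>

lemma v_number_eq_1_iff:
  fixes I :: "('a, 'k::field) bpoly set"
  assumes ex: "f \<in> graded_component V d" "primeideal (colon (poly_ring V) I f) (poly_ring V)"
  shows "v_number V I = 1 \<longleftrightarrow>
     (\<exists>f\<in>graded_component V 1. primeideal (colon (poly_ring V) I f) (poly_ring V)) \<and>
     \<not> (\<exists>f\<in>graded_component V 0. primeideal (colon (poly_ring V) I f) (poly_ring V))"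
proof -
  define S where "S = {d. \<exists>f\<in>graded_component V d. primeideal (colon (poly_ring V) I f) (poly_ring V)}"
  have "v_number V I = Inf S"
    unfolding v_number_def S_def assoc_primes_def
    by (rule arg_cong[of _ _ Inf]) (auto simp: graded_component_def)
  moreover have "S \<noteq> {}"
    using ex by (auto simp: S_def)
  then have "Inf S \<in> S"
    by (rule Inf_nat_def1)
  then have "Inf S = 1 \<longleftrightarrow> 1 \<in> S \<and> 0 \<notin> S"
    using wellorder_Inf_le1[of 0 S] wellorder_Inf_le1[of 1 S]
    by (metis le_0_eq le_neq_implies_less less_one zero_neq_one)
  ultimately show ?thesis
    by (simp add: S_def)
qed

text \<open>A cone over \<open>H\<close> is complete precisely when \<open>H\<close> is, so the condition on \<open>H\<close> becomes one on \<open>G\<close>.\<close>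

lemma cone_iff_dominating_vertex:
  assumes G: "simple_graph G"
  shows "(\<exists>v H. simple_graph H \<and> \<not> complete_graph H \<and> v \<notin> verts H \<and> G = cone v H) \<longleftrightarrow>
    \<not> complete_graph G \<and>
    (\<exists>v\<in>verts G. \<forall>u\<in>verts G. u \<noteq> v \<longrightarrow> {u, v} \<in> edges G)" (is "?L \<longleftrightarrow> ?R")
proof
  assume ?L
  then obtain v H where H: "simple_graph H" "\<not> complete_graph H" "v \<notin> verts H" "G = cone v H"
    by blast
  then obtain u w where uw: "u \<in> verts H" "w \<in> verts H" "u \<noteq> w" "{u, w} \<notin> edges H"
    by (auto simp: complete_graph_def)
  then have "{u, w} \<notin> edges G"
    using H(3,4) by (auto simp: cone_def doubleton_eq_iff)
  then show ?R
    using uw H(4) by (auto simp: complete_graph_def cone_def)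
next
  assume R: ?R
  then obtain v where v: "v \<in> verts G" and dom: "\<And>u. u \<in> verts G \<Longrightarrow> u \<noteq> v \<Longrightarrow> {u, v} \<in> edges G"
    by blast
  define H where "H = \<lparr>verts = verts G - {v}, edges = {e \<in> edges G. v \<notin> e}\<rparr>"
  have "e \<in> edges H \<union> {{u, v} | u. u \<in> verts H}" if e: "e \<in> edges G" for e
  proof (cases "v \<in> e")
    case True
    have "card e = 2" "e \<subseteq> verts G"
      using G e by (auto simp: simple_graph_def)
    then obtain x y where "e = {x, y}" "x \<noteq> y"
      by (meson card_2_iff)
    with True obtain u where "e = {u, v}" "u \<noteq> v"
      by (metis doubleton_eq_iff insertE singletonD)
    moreover from this have "u \<in> verts H"
      using \<open>e \<subseteq> verts G\<close> by (simp add: H_def)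
    ultimately show ?thesis by blast
  qed (use e in \<open>simp add: H_def\<close>)
  moreover have "edges H \<subseteq> edges G" "{{u, v} | u. u \<in> verts H} \<subseteq> edges G"
    using dom by (auto simp: H_def)
  ultimately have "edges G = edges H \<union> {{u, v} | u. u \<in> verts H}"
    by blast
  then have "G = cone v H"
    using v unfolding cone_def by (cases G) (simp add: H_def insert_absorb)
  moreover have "simple_graph H"
    using G by (auto simp: simple_graph_def H_def)
  moreover have "\<not> complete_graph H"
  proof
    assume H: "complete_graph H"
    have "{u, w} \<in> edges G" if "u \<in> verts G" "w \<in> verts G" "u \<noteq> w" for u w
    proof (cases "u = v \<or> w = v")
      case True
      then show ?thesis
        using dom[of u] dom[of w] that by (auto simp: insert_commute)
    next
      case False
      then show ?thesis
        using H that by (simp add: complete_graph_def H_def)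
    qed
    with R show False by (auto simp: complete_graph_def)
  qed
  moreover have "v \<notin> verts H"
    by (simp add: H_def)
  ultimately show ?L by blast
qed

theorem theorem3p20:
  fixes G :: "'a::linorder graph"
  assumes "finite (verts G)" and "simple_graph G" and "connected_graph G"
  shows "v_number (verts G) (binomial_edge_ideal G :: ('a, 'k::field) bpoly set) = 1
    \<longleftrightarrow> (\<exists>v H. simple_graph H \<and> \<not> complete_graph H \<and> v \<notin> verts H \<and> G = cone v H)"
proof -
  let ?R = "poly_ring (verts G) :: ('a, 'k) bpoly ring"
  let ?J = "binomial_edge_ideal G :: ('a, 'k) bpoly set"
  note J = poly_ring_idealD[OF edge_ideal_is_ideal[OF assms(2)]]
  have degree_0: "(\<exists>f\<in>graded_component (verts G) 0. primeideal (colon ?R ?J f) ?R) \<longleftrightarrow>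
      complete_graph G"
  proof
    assume "complete_graph G"
    then have J_eq: "?J = segre_kernel (verts G)"
      by (rule edge_ideal_complete[OF assms(2)])
    have "colon ?R ?J 1 = ?J"
      using J(1) by (auto simp: colon_def)
    then have "primeideal (colon ?R ?J 1) ?R"
      using segre_kernel_prime by (simp add: J_eq)
    then show "\<exists>f\<in>graded_component (verts G) 0. primeideal (colon ?R ?J f) ?R"
      by (rule bexI) (simp add: graded_component_def poly_ring_closed mon_degree_def)
  next
    assume "\<exists>f\<in>graded_component (verts G) 0. primeideal (colon ?R ?J f) ?R"
    then obtain f where f: "f \<in> graded_component (verts G) 0" and P: "primeideal (colon ?R ?J f) ?R"
      by blast
    have "f \<noteq> 0"
      using edge_ideal_is_ideal[OF assms(2)] P by (rule colon_zero_not_prime)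
    have keys: "m = 0" if "m \<in> Poly_Mapping.keys f" for m
      using f that by (auto simp: graded_component_def intro: mon_degree_eq_0D)
    show "complete_graph G"
      unfolding complete_graph_def
    proof (intro ballI impI)
      fix u w assume uw: "u \<in> verts G" "w \<in> verts G" "u \<noteq> w"
      have in_J: "minor u w * f \<in> ?J"
        by (rule low_degree_times_minor_in_edge_ideal[OF assms(2,3) f _ P uw(1,2)]) simp
      show "{u, w} \<in> edges G"
      proof (rule ccontr)
        assume "{u, w} \<notin> edges G"
        \<comment> \<open>The minor takes the value one at this point, so the constant \<open>f\<close> would have to be zero.\<close>
        let ?c = "\<lambda>z. of_bool (z = X u \<or> z = Y w) :: 'k"
        have "eval_at ?c (minor u w * f) = 0"
          by (rule eval_edge_ideal_nonadjacent[OF assms(2) in_J \<open>{u, w} \<notin> edges G\<close>]) auto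
        then have "eval_at ?c f = 0"
          using uw(3) by (simp add: eval.ext_mult eval_minor)
        moreover have "eval_at ?c f = Poly_Mapping.lookup f 0"
        proof -
          have "Poly_Mapping.keys f = {0}"
            using keys \<open>f \<noteq> 0\<close> keys_eq_empty[of f] by blast
          then show ?thesis by (simp add: eval.ext_def)
        qed
        ultimately have "0 \<notin> Poly_Mapping.keys f"
          by (simp add: in_keys_iff)
        then have "Poly_Mapping.keys f = {}"
          using keys by blast
        then show False
          using \<open>f \<noteq> 0\<close> by simp
      qed
    qed
  qed
  have degree_1: "(\<exists>f\<in>graded_component (verts G) 1. primeideal (colon ?R ?J f) ?R) \<longleftrightarrow>
      (\<exists>v\<in>verts G. \<forall>u\<in>verts G. u \<noteq> v \<longrightarrow> {u, v} \<in> edges G)"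
  proof
    assume "\<exists>v\<in>verts G. \<forall>u\<in>verts G. u \<noteq> v \<longrightarrow> {u, v} \<in> edges G"
    then obtain v where v: "v \<in> verts G" "\<And>u. u \<in> verts G \<Longrightarrow> u \<noteq> v \<Longrightarrow> {u, v} \<in> edges G"
      by blast
    have "colon ?R ?J (var_poly (X v)) = segre_kernel (verts G)"
      by (rule colon_dominating_vertex[OF assms(2)]) (use v in auto)
    then have "primeideal (colon ?R ?J (var_poly (X v))) ?R"
      using segre_kernel_prime[of "verts G"] by simp
    moreover have "var_poly (X v) \<in> graded_component (verts G) 1"
      using poly_ring_var_closed(1)[OF v(1)] by (simp add: graded_component_def var_poly_def)
    ultimately show "\<exists>f\<in>graded_component (verts G) 1. primeideal (colon ?R ?J f) ?R"
      by blast
  next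
    assume "\<exists>f\<in>graded_component (verts G) 1. primeideal (colon ?R ?J f) ?R"
    then obtain f where f: "f \<in> graded_component (verts G) 1" and P: "primeideal (colon ?R ?J f) ?R"
      by blast
    have "f \<noteq> 0"
      using edge_ideal_is_ideal[OF assms(2)] P by (rule colon_zero_not_prime)
    then obtain m where m: "m \<in> Poly_Mapping.keys f"
      by (metis keys_eq_empty equals0I)
    with f obtain z where z: "m = Poly_Mapping.single z 1" "vertex z \<in> verts G"
      by (rule graded_component_1_keys)
    have "{u, vertex z} \<in> edges G" if u: "u \<in> verts G" "u \<noteq> vertex z" for u
    proof (rule ccontr)
      assume "{u, vertex z} \<notin> edges G"
      then have "{vertex z, u} \<notin> edges G"
        by (simp add: insert_commute)
      have in_J: "minor (vertex z) u * f \<in> ?J"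
        using low_degree_times_minor_in_edge_ideal[OF assms(2,3) f order_refl P z(2) u(1)] .
      have "Poly_Mapping.lookup f (Poly_Mapping.single z 1) = 0"
        using nonadjacent_coefficients_zero[OF assms(2) _ \<open>{vertex z, u} \<notin> edges G\<close> f in_J] u(2)
        by (cases z) auto
      with m z show False
        by (simp add: in_keys_iff)
    qed
    with z show "\<exists>v\<in>verts G. \<forall>u\<in>verts G. u \<noteq> v \<longrightarrow> {u, v} \<in> edges G"
      by blast
  qed
  obtain m where m: "(Poly_Mapping.single m 1 :: ('a, 'k) bpoly) \<in> carrier ?R"
    "colon ?R ?J (Poly_Mapping.single m 1) = segre_kernel (verts G)"
    using ex_colon_monomial_eq_segre_kernel[OF assms] by blast
  have "(Poly_Mapping.single m 1 :: ('a, 'k) bpoly) \<in> graded_component (verts G) (mon_degree m)"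
    using m(1) by (simp add: graded_component_def)
  moreover have "primeideal (colon ?R ?J (Poly_Mapping.single m 1)) ?R"
    unfolding m(2) by (rule segre_kernel_prime)
  ultimately have "v_number (verts G) ?J = 1 \<longleftrightarrow>
      (\<exists>v\<in>verts G. \<forall>u\<in>verts G. u \<noteq> v \<longrightarrow> {u, v} \<in> edges G) \<and> \<not> complete_graph G"
    by (simp only: v_number_eq_1_iff degree_0 degree_1)
  then show ?thesis
    unfolding cone_iff_dominating_vertex[OF assms(2)] by blast
qed

end
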